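(* Let $m\ge 1$ be an integer, let $A=\mathbb{Z}_m$ and $X=\mathbb{Z}_m$ (the integers modulo $m$), and let $d,s,n\in\mathbb{Z}_m^{\times}$ be units, making $X$ a finite Alexander biquasile with operations $x\ast y=-dsn^2x+ny$ and $x\cdot y=dx+sy$. Then for every $\gamma\in\mathbb{Z}_m$, the map $\phi:X^3\to\mathbb{Z}_m$ given by $$\phi(x,y,z)=-\gamma(s^{-1}n^{-1}+dn)\,x+\gamma s^{-1}d\,y+\gamma z$$ is a biquasile Boltzmann weight on $X$ with values in $A$.
   Context: With the operations $x\ast y=-dsn^2x+ny$ and $x\cdot y=dx+sy$ ($d,s,n$ units of a commutative ring with identity), the ring is a biquasile, called an Alexander biquasile; in particular $\ast$ and $\cdot$ are quasigroup operations. Their divisions are: $y\backslash^{\ast}x$ is the unique $z$ with $y\ast z=x$; $y\backslash x$ is the unique $z$ with $y\cdot z=x$; $x/y$ is the unique $z$ with $z\cdot y=x$. Biquasile Boltzmann weight on $X$ with values in an abelian group $A$: a function $\phi:X^3\to A$ such that for all $x,y,a,b\in X$: (i) $\phi(x,a,a\backslash(x\backslash^{\ast}x))=\phi(x,(x\backslash^{\ast}x)/b,b)=0$, and (ii) $\phi(x,a,b)+\phi(b,x\ast(a\cdot b),y)+\phi(x\ast(a\cdot b),a,b\ast([x\ast(a\cdot b)]\cdot y))=\phi(b,x,y)+\phi(x,a,b\ast(x\cdot y))+\phi(b\ast(x\cdot y),x\ast(a\cdot[b\ast(x\cdot y)]),y)$. *)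

theory Defs
  imports "HOL-Algebra.IntRing"
begin

locale quasigroup =
  fixes X :: "'a set" and f :: "'a \<Rightarrow> 'a \<Rightarrow> 'a"
  assumes closed: "\<lbrakk>x \<in> X; y \<in> X\<rbrakk> \<Longrightarrow> f x y \<in> X"
    and left_divisible: "\<lbrakk>x \<in> X; y \<in> X\<rbrakk> \<Longrightarrow> \<exists>!z. z \<in> X \<and> f y z = x"
    and right_divisible: "\<lbrakk>x \<in> X; y \<in> X\<rbrakk> \<Longrightarrow> \<exists>!z. z \<in> X \<and> f z y = x"

(* left_div X f y x is y \ x and right_div X f x y is x / y. *)

definition left_div :: "'a set \<Rightarrow> ('a \<Rightarrow> 'a \<Rightarrow> 'a) \<Rightarrow> 'a \<Rightarrow> 'a \<Rightarrow> 'a"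
  where "left_div X f y x = (THE z. z \<in> X \<and> f y z = x)"

definition right_div :: "'a set \<Rightarrow> ('a \<Rightarrow> 'a \<Rightarrow> 'a) \<Rightarrow> 'a \<Rightarrow> 'a \<Rightarrow> 'a"
  where "right_div X f x y = (THE z. z \<in> X \<and> f z y = x)"

locale biquasile =
  star: quasigroup X star + dot: quasigroup X dot
  for X :: "'a set"
    and star :: "'a \<Rightarrow> 'a \<Rightarrow> 'a"  (infixl \<open>\<star>\<close> 70)
    and dot :: "'a \<Rightarrow> 'a \<Rightarrow> 'a"  (infixl \<open>\<cdot>\<close> 70) +
  assumes exchange1: "\<lbrakk>a \<in> X; b \<in> X; x \<in> X; y \<in> X\<rbrakk> \<Longrightarrow>
      a \<star> (x \<cdot> (y \<star> (a \<cdot> b))) = (a \<star> (x \<cdot> y)) \<star> (x \<cdot> (y \<star> ((a \<star> (x \<cdot> y)) \<cdot> b)))"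
    and exchange2: "\<lbrakk>a \<in> X; b \<in> X; x \<in> X; y \<in> X\<rbrakk> \<Longrightarrow>
      y \<star> ((a \<star> (x \<cdot> y)) \<cdot> b) = (y \<star> (a \<cdot> b)) \<star> ((a \<star> (x \<cdot> (y \<star> (a \<cdot> b)))) \<cdot> b)"

(* The abelian group of values is the additive structure of the record A;
   the multiplicative fields of A play no role. *)

locale biquasile_boltzmann_weight =
  biquasile X star dot + abelian_group A
  for X :: "'a set"
    and star :: "'a \<Rightarrow> 'a \<Rightarrow> 'a"  (infixl \<open>\<star>\<close> 70)
    and dot :: "'a \<Rightarrow> 'a \<Rightarrow> 'a"  (infixl \<open>\<cdot>\<close> 70)
    and A :: "('b, 'm) ring_scheme"  (structure) +
  fixes \<phi> :: "'a \<Rightarrow> 'a \<Rightarrow> 'a \<Rightarrow> 'b"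
  assumes weight_closed: "\<lbrakk>x \<in> X; y \<in> X; z \<in> X\<rbrakk> \<Longrightarrow> \<phi> x y z \<in> carrier A"
    and weight_left_div: "\<lbrakk>x \<in> X; a \<in> X\<rbrakk> \<Longrightarrow>
      \<phi> x a (left_div X (\<cdot>) a (left_div X (\<star>) x x)) = \<zero>"
    and weight_right_div: "\<lbrakk>x \<in> X; b \<in> X\<rbrakk> \<Longrightarrow>
      \<phi> x (right_div X (\<cdot>) (left_div X (\<star>) x x) b) b = \<zero>"
    and weight_exchange: "\<lbrakk>x \<in> X; y \<in> X; a \<in> X; b \<in> X\<rbrakk> \<Longrightarrow>
      \<phi> x a b \<oplus> \<phi> b (x \<star> (a \<cdot> b)) y \<oplus> \<phi> (x \<star> (a \<cdot> b)) a (b \<star> ((x \<star> (a \<cdot> b)) \<cdot> y))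
      = \<phi> b x y \<oplus> \<phi> x a (b \<star> (x \<cdot> y)) \<oplus> \<phi> (b \<star> (x \<cdot> y)) (x \<star> (a \<cdot> (b \<star> (x \<cdot> y)))) y"

definition alexander_star ::
    "('a, 'm) ring_scheme \<Rightarrow> 'a \<Rightarrow> 'a \<Rightarrow> 'a \<Rightarrow> 'a \<Rightarrow> 'a \<Rightarrow> 'a"
  where "alexander_star R d s n x y =
    (\<ominus>\<^bsub>R\<^esub> (d \<otimes>\<^bsub>R\<^esub> s \<otimes>\<^bsub>R\<^esub> (n [^]\<^bsub>R\<^esub> (2::nat)) \<otimes>\<^bsub>R\<^esub> x)) \<oplus>\<^bsub>R\<^esub> (n \<otimes>\<^bsub>R\<^esub> y)"

definition alexander_dot ::
    "('a, 'm) ring_scheme \<Rightarrow> 'a \<Rightarrow> 'a \<Rightarrow> 'a \<Rightarrow> 'a \<Rightarrow> 'a"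
  where "alexander_dot R d s x y = (d \<otimes>\<^bsub>R\<^esub> x) \<oplus>\<^bsub>R\<^esub> (s \<otimes>\<^bsub>R\<^esub> y)"

end

theory Submission
  imports Defs
begin

text \<open>
  The weight is a coboundary. Put \<open>h u = \<gamma> s\<^sup>-\<^sup>1 n\<^sup>-\<^sup>1 u\<close>. Since
  \<open>x \<star> (a \<cdot> b) = - d s n\<^sup>2 x + n d a + n s b\<close>, dividing by \<open>s n\<close> gives
  \<open>\<phi> x a b = h (x \<star> (a \<cdot> b)) - h x\<close> (\<open>alexander_weight_eq_coboundary\<close>).

  In every biquasile, and for every map \<open>h\<close> into an abelian group, such a coboundary is a Boltzmann
  weight (\<open>coboundary_weight\<close>). The divisions in the two vanishing axioms are chosen so that
  \<open>x \<star> (a \<cdot> b) = x\<close>, which makes the weight vanish. In the exchange axiom both sides telescope: all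
  values of \<open>h\<close> at intermediate labels cancel, and what remains are the values of \<open>h\<close> at the final
  labels minus those at the initial labels \<open>x\<close> and \<open>b\<close>. The two exchange laws of a biquasile
  say that the final labels on the two sides agree.

  That the Alexander operations form a biquasile (\<open>alexander_biquasile\<close>) is a computation in a
  commutative ring: linear maps with unit coefficients are quasigroup operations, and the
  coefficient \<open>- d s n\<^sup>2\<close> makes the exchange laws hold.
\<close>

lemma (in quasigroup) left_div:
  assumes "x \<in> X" "y \<in> X"
  shows left_div_closed: "left_div X f y x \<in> X" and left_div_cancel: "f y (left_div X f y x) = x"
  using theI'[OF left_divisible[OF assms]] unfolding left_div_def by auto

lemma (in quasigroup) right_div:
  assumes "x \<in> X" "y \<in> X"
  shows right_div_closed: "right_div X f x y \<in> X" and right_div_cancel: "f (right_div X f x y) y = x"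
  using theI'[OF right_divisible[OF assms]] unfolding right_div_def by auto

text \<open>
  Each value of \<open>\<phi>\<close> is the change of \<open>h\<close> from the label \<open>x\<close> to the label \<open>x \<star> (a \<cdot> b)\<close> that replaces
  it, so a sum of weights along a chain of replacements depends only on its two ends.
  The hypothesis on \<open>\<phi>\<close> is only imposed on \<open>X\<close>, because a weight is given by a function on the whole
  type, whose values outside \<open>X\<close> are arbitrary.
\<close>

lemma (in biquasile) coboundary_weight:
  fixes A :: "('b, 'm) ring_scheme" (structure)
  assumes "abelian_group A"
    and h: "\<And>x. x \<in> X \<Longrightarrow> h x \<in> carrier A"
    and \<phi>: "\<And>x a b. \<lbrakk>x \<in> X; a \<in> X; b \<in> X\<rbrakk> \<Longrightarrow> \<phi> x a b = h (x \<star> (a \<cdot> b)) \<ominus> h x"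
  shows "biquasile_boltzmann_weight X (\<star>) (\<cdot>) A \<phi>"
proof -
  interpret A: abelian_group A by fact
  note [simp] = star.closed dot.closed h
  show ?thesis
  proof unfold_locales
    fix x y z assume "x \<in> X" "y \<in> X" "z \<in> X"
    then show "\<phi> x y z \<in> carrier A" by (simp add: \<phi>)
  next
    fix x a assume "x \<in> X" "a \<in> X"
    then show "\<phi> x a (left_div X (\<cdot>) a (left_div X (\<star>) x x)) = \<zero>"
      by (simp add: \<phi> star.left_div dot.left_div A.minus_eq A.r_neg)
  next
    fix x b assume "x \<in> X" "b \<in> X"
    then show "\<phi> x (right_div X (\<cdot>) (left_div X (\<star>) x x) b) b = \<zero>"
      by (simp add: \<phi> star.left_div dot.right_div A.minus_eq A.r_neg)
  next
    fix x y a b assume [simp]: "x \<in> X" "y \<in> X" "a \<in> X" "b \<in> X"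
    \<comment> \<open>The labels \<open>x, b\<close> become \<open>p, q\<close>, through \<open>c\<close> on the left and through \<open>e\<close> on the right.\<close>
    define c where "c = x \<star> (a \<cdot> b)"
    define e where "e = b \<star> (x \<cdot> y)"
    define p where "p = x \<star> (a \<cdot> e)"
    define q where "q = b \<star> (c \<cdot> y)"
    have [simp]: "c \<in> X" "e \<in> X" "p \<in> X" "q \<in> X"
      by (simp_all add: c_def e_def p_def q_def)
    have p: "c \<star> (a \<cdot> q) = p"
      unfolding c_def q_def p_def e_def by (simp add: exchange1)
    have q: "e \<star> (p \<cdot> y) = q"
      unfolding c_def q_def p_def e_def by (simp add: exchange2)
    have "\<phi> x a b \<oplus> \<phi> b c y \<oplus> \<phi> c a q = (h c \<ominus> h x) \<oplus> (h q \<ominus> h b) \<oplus> (h p \<ominus> h c)"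
      by (simp add: \<phi> p flip: c_def q_def)
    also have "\<dots> = (h p \<oplus> h q \<oplus> \<ominus> h x \<oplus> \<ominus> h b) \<oplus> (h c \<oplus> \<ominus> h c)"
      by (simp add: A.minus_eq A.a_ac)
    also have "\<dots> = (h p \<oplus> h q \<oplus> \<ominus> h x \<oplus> \<ominus> h b) \<oplus> (h e \<oplus> \<ominus> h e)"
      by (simp add: A.r_neg)
    also have "\<dots> = (h e \<ominus> h b) \<oplus> (h p \<ominus> h x) \<oplus> (h q \<ominus> h e)"
      by (simp add: A.minus_eq A.a_ac)
    also have "\<dots> = \<phi> b x y \<oplus> \<phi> x a e \<oplus> \<phi> e p y"
      by (simp add: \<phi> q flip: e_def p_def)
    finally show "\<phi> x a b \<oplus> \<phi> b (x \<star> (a \<cdot> b)) y \<oplus> \<phi> (x \<star> (a \<cdot> b)) a (b \<star> ((x \<star> (a \<cdot> b)) \<cdot> y))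
      = \<phi> b x y \<oplus> \<phi> x a (b \<star> (x \<cdot> y)) \<oplus> \<phi> (b \<star> (x \<cdot> y)) (x \<star> (a \<cdot> (b \<star> (x \<cdot> y)))) y"
      by (simp add: c_def e_def p_def q_def)
  qed
qed

text \<open>
  Each of the equations \<open>u x + v z = w\<close> and \<open>u z + v x = w\<close> is solved for \<open>z\<close> by inverting one unit.
\<close>

lemma (in cring) linear_quasigroup:
  assumes u: "u \<in> Units R" and v: "v \<in> Units R"
  shows "quasigroup (carrier R) (\<lambda>x y. u \<otimes> x \<oplus> v \<otimes> y)"
proof
  note [simp] = Units_closed[OF u] Units_closed[OF v]
  have solve: "\<exists>!z. z \<in> carrier R \<and> w' \<otimes> y \<oplus> w \<otimes> z = x"
    if w: "w \<in> Units R" and [simp]: "w' \<in> carrier R" "x \<in> carrier R" "y \<in> carrier R" for w w' x y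
  proof (rule ex1I)
    note [simp] = Units_closed[OF w] Units_inv_closed[OF w]
    have "w \<otimes> (inv w \<otimes> (x \<ominus> w' \<otimes> y)) = x \<ominus> w' \<otimes> y"
      using w by (simp add: Units_r_inv flip: m_assoc)
    then show "inv w \<otimes> (x \<ominus> w' \<otimes> y) \<in> carrier R \<and> w' \<otimes> y \<oplus> w \<otimes> (inv w \<otimes> (x \<ominus> w' \<otimes> y)) = x"
      by (simp add: minus_eq a_lcomm r_neg)
    show "z = inv w \<otimes> (x \<ominus> w' \<otimes> y)" if "z \<in> carrier R \<and> w' \<otimes> y \<oplus> w \<otimes> z = x" for z
    proof -
      from that have [simp]: "z \<in> carrier R" and x: "x = w' \<otimes> y \<oplus> w \<otimes> z" by simp_all
      have "x \<ominus> w' \<otimes> y = w \<otimes> z \<oplus> (w' \<otimes> y \<ominus> w' \<otimes> y)"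
        unfolding x by (simp add: minus_eq a_ac)
      also have "\<dots> = w \<otimes> z"
        by (simp add: minus_eq r_neg)
      finally show ?thesis using w by (simp add: Units_l_inv flip: m_assoc)
    qed
  qed
  fix x y assume xy [simp]: "x \<in> carrier R" "y \<in> carrier R"
  show "u \<otimes> x \<oplus> v \<otimes> y \<in> carrier R" by simp
  show "\<exists>!z. z \<in> carrier R \<and> u \<otimes> y \<oplus> v \<otimes> z = x" by (rule solve[OF v]) simp_all
  have "(u \<otimes> z \<oplus> v \<otimes> y = x) = (v \<otimes> y \<oplus> u \<otimes> z = x)" if "z \<in> carrier R" for z
    using that by (simp add: a_comm)
  then show "\<exists>!z. z \<in> carrier R \<and> u \<otimes> z \<oplus> v \<otimes> y = x"
    using solve[OF u, of v x y] by (simp cong: conj_cong)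
qed

lemma (in cring) alexander_star_dot:
  assumes "d \<in> carrier R" "s \<in> carrier R" "n \<in> carrier R"
    and "x \<in> carrier R" "a \<in> carrier R" "b \<in> carrier R"
  shows "alexander_star R d s n x (alexander_dot R d s a b)
    = \<ominus> (d \<otimes> s \<otimes> n \<otimes> n \<otimes> x) \<oplus> n \<otimes> d \<otimes> a \<oplus> n \<otimes> s \<otimes> b"
  using assms unfolding alexander_star_def alexander_dot_def
  by (simp add: numeral_2_eq_2) algebra

text \<open>
  Both sides of each exchange law are instances of one expression, the left-hand side of the
  corresponding lemma below, that differ only in \<open>t\<close>. The coefficient \<open>- d s n\<^sup>2\<close> is the one for which
  the two contributions of \<open>t\<close> to that expression cancel.
\<close>

lemma (in cring) alexander_exchange1:
  assumes [simp]: "d \<in> carrier R" "s \<in> carrier R" "n \<in> carrier R"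
    and [simp]: "t \<in> carrier R" "x \<in> carrier R" "y \<in> carrier R" "b \<in> carrier R"
  shows "alexander_star R d s n t (alexander_dot R d s x
      (alexander_star R d s n y (alexander_dot R d s t b)))
    = n \<otimes> d \<otimes> x \<oplus> \<ominus> (n \<otimes> s \<otimes> d \<otimes> s \<otimes> n \<otimes> n \<otimes> y) \<oplus> n \<otimes> s \<otimes> n \<otimes> s \<otimes> b" (is "?l = ?r")
proof -
  have "?l = ?r \<oplus> (\<ominus> (d \<otimes> s \<otimes> n \<otimes> n \<otimes> t) \<oplus> d \<otimes> s \<otimes> n \<otimes> n \<otimes> t)"
    by (simp add: alexander_star_dot r_distr r_minus l_minus m_ac a_ac)
  then show ?thesis by (simp add: l_neg)
qed

lemma (in cring) alexander_exchange2:
  assumes [simp]: "d \<in> carrier R" "s \<in> carrier R" "n \<in> carrier R"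
    and [simp]: "t \<in> carrier R" "a \<in> carrier R" "x \<in> carrier R" "b \<in> carrier R"
  shows "alexander_star R d s n t (alexander_dot R d s
      (alexander_star R d s n a (alexander_dot R d s x t)) b)
    = \<ominus> (n \<otimes> d \<otimes> d \<otimes> s \<otimes> n \<otimes> n \<otimes> a) \<oplus> n \<otimes> d \<otimes> n \<otimes> d \<otimes> x \<oplus> n \<otimes> s \<otimes> b" (is "?l = ?r")
proof -
  have "?l = ?r \<oplus> (\<ominus> (d \<otimes> s \<otimes> n \<otimes> n \<otimes> t) \<oplus> d \<otimes> s \<otimes> n \<otimes> n \<otimes> t)"
    by (simp add: alexander_star_dot r_distr r_minus l_minus m_ac a_ac)
  then show ?thesis by (simp add: l_neg)
qed

lemma (in cring) alexander_biquasile: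
  assumes d: "d \<in> Units R" and s: "s \<in> Units R" and n: "n \<in> Units R"
  shows "biquasile (carrier R) (alexander_star R d s n) (alexander_dot R d s)"
proof -
  note [simp] = Units_closed[OF d] Units_closed[OF s] Units_closed[OF n]
  have minus_unit: "\<ominus> u \<in> Units R" if u: "u \<in> Units R" for u
  proof -
    have "u \<in> carrier R" "inv u \<in> carrier R" using u by auto
    then have "\<ominus> u \<in> carrier R" "\<ominus> (inv u) \<in> carrier R"
      "\<ominus> (inv u) \<otimes> \<ominus> u = \<one>" "\<ominus> u \<otimes> \<ominus> (inv u) = \<one>"
      using u by (simp_all add: l_minus r_minus Units_l_inv Units_r_inv)
    then show ?thesis unfolding Units_def by blast
  qed
  have unit: "\<ominus> (d \<otimes> s \<otimes> (n [^] (2::nat))) \<in> Units R"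
    using d s n by (simp add: minus_unit numeral_2_eq_2)
  have star: "quasigroup (carrier R) (alexander_star R d s n)"
  proof -
    interpret L: quasigroup "carrier R" "\<lambda>x y. \<ominus> (d \<otimes> s \<otimes> (n [^] (2::nat))) \<otimes> x \<oplus> n \<otimes> y"
      by (rule linear_quasigroup[OF unit n])
    show ?thesis
      using L.closed L.left_divisible L.right_divisible
      by unfold_locales (simp_all add: alexander_star_def l_minus cong: conj_cong)
  qed
  have dot: "quasigroup (carrier R) (alexander_dot R d s)"
    using linear_quasigroup[OF d s] by (simp add: alexander_dot_def[abs_def])
  interpret star: quasigroup "carrier R" "alexander_star R d s n" by (rule star)
  interpret dot: quasigroup "carrier R" "alexander_dot R d s" by (rule dot)
  show ?thesis
  proof unfold_locales
    fix a b x y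
    note [simp] = star.closed dot.closed
    assume [simp]: "a \<in> carrier R" "b \<in> carrier R" "x \<in> carrier R" "y \<in> carrier R"
    let ?star = "alexander_star R d s n" and ?dot = "alexander_dot R d s"
    show "?star a (?dot x (?star y (?dot a b)))
      = ?star (?star a (?dot x y)) (?dot x (?star y (?dot (?star a (?dot x y)) b)))"
      by (simp add: alexander_exchange1)
    show "?star y (?dot (?star a (?dot x y)) b)
      = ?star (?star y (?dot a b)) (?dot (?star a (?dot x (?star y (?dot a b)))) b)"
      by (simp add: alexander_exchange2)
  qed
qed

text \<open>
  The factors \<open>s\<^sup>-\<^sup>1 n\<^sup>-\<^sup>1\<close> turn \<open>x \<star> (y \<cdot> z)\<close> into \<open>- d n x + s\<^sup>-\<^sup>1 d y + z\<close>, whose last two coefficients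
  are those of the weight up to the factor \<open>\<gamma>\<close>. Subtracting \<open>s\<^sup>-\<^sup>1 n\<^sup>-\<^sup>1 x\<close> then
  completes the coefficient of \<open>x\<close>.
\<close>

lemma (in cring) alexander_weight_eq_coboundary:
  assumes d: "d \<in> Units R" and s: "s \<in> Units R" and n: "n \<in> Units R"
    and [simp]: "\<gamma> \<in> carrier R" "x \<in> carrier R" "y \<in> carrier R" "z \<in> carrier R"
  shows "\<ominus> (\<gamma> \<otimes> (inv s \<otimes> inv n \<oplus> d \<otimes> n) \<otimes> x) \<oplus> \<gamma> \<otimes> inv s \<otimes> d \<otimes> y \<oplus> \<gamma> \<otimes> z
    = \<gamma> \<otimes> inv s \<otimes> inv n \<otimes> alexander_star R d s n x (alexander_dot R d s y z)
      \<ominus> \<gamma> \<otimes> inv s \<otimes> inv n \<otimes> x"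
proof -
  note [simp] = Units_closed[OF d] Units_closed[OF s] Units_closed[OF n]
    Units_inv_closed[OF s] Units_inv_closed[OF n]
  \<comment> \<open>Multiply out, keeping the factors that cancel next to each other.\<close>
  have "\<gamma> \<otimes> inv s \<otimes> inv n \<otimes> alexander_star R d s n x (alexander_dot R d s y z)
    = \<gamma> \<otimes> (\<ominus> (d \<otimes> (inv s \<otimes> s) \<otimes> (inv n \<otimes> n) \<otimes> n \<otimes> x)
        \<oplus> (inv n \<otimes> n) \<otimes> inv s \<otimes> d \<otimes> y \<oplus> (inv s \<otimes> s) \<otimes> (inv n \<otimes> n) \<otimes> z)"
    by (simp add: alexander_star_dot r_distr r_minus l_minus m_ac)
  also have "\<dots> = \<gamma> \<otimes> (\<ominus> (d \<otimes> n \<otimes> x) \<oplus> inv s \<otimes> d \<otimes> y \<oplus> z)"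
    using s n by (simp add: Units_l_inv)
  finally show ?thesis
    by (simp add: minus_eq minus_add r_distr l_distr r_minus l_minus m_ac a_ac)
qed

theorem proposition3:
  fixes m :: int
    and R :: "int set ring"  (structure)
    and d s n \<gamma> :: "int set"
  assumes "m \<ge> 1"
    and "R = ZFact m"
    and "d \<in> Units R" and "s \<in> Units R" and "n \<in> Units R"
    and "\<gamma> \<in> carrier R"
  shows "biquasile_boltzmann_weight (carrier R) (alexander_star R d s n) (alexander_dot R d s) R
    (\<lambda>x y z. (\<ominus> (\<gamma> \<otimes> (inv s \<otimes> inv n \<oplus> d \<otimes> n) \<otimes> x)) \<oplus> (\<gamma> \<otimes> inv s \<otimes> d \<otimes> y) \<oplus> (\<gamma> \<otimes> z))"
proof -
  interpret cring R unfolding assms(2) by (rule ZFact_is_cring)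
  interpret biquasile "carrier R" "alexander_star R d s n" "alexander_dot R d s"
    using assms by (intro alexander_biquasile)
  show ?thesis
  proof (rule coboundary_weight)
    show "abelian_group R" ..
    show "\<gamma> \<otimes> inv s \<otimes> inv n \<otimes> x \<in> carrier R" if "x \<in> carrier R" for x
      using assms(3-) that by simp
  qed (use assms(3-) in \<open>rule alexander_weight_eq_coboundary\<close>)
qed

end
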